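(* For every $x\in\mathbb{C}\setminus\{0,-1,-2,\dots\}$ the following two identities hold: $$\pi\frac{\Gamma(x)\Gamma(x+1)}{\Gamma^2\left(x+\frac12\right)}=\sum_{n=0}^{\infty}\frac{4n+2x+1}{(2n+1)(n+x)}\,\frac{\left(\frac12+x\right)_n}{(1+x)_n}\binom{2n}{n}\frac{1}{2^{2n}},$$ $$4\pi\frac{\Gamma(x)\Gamma(x+1)}{\Gamma^2\left(x+\frac12\right)}=\sum_{n=0}^{\infty}\frac{2(2n+1)^2(15n+2)+x\,P(n,x)}{(2n+1)(2n+x)(2n+x+1)^2}\,\frac{\left(\frac12+x\right)_n^2}{\left(1+\frac x2\right)_n\left(\frac{1+x}{2}\right)_n}\binom{2n}{n}\frac{1}{2^{6n}},$$ where $P(n,x)=(2n+1)(86n+19)+4x(20n+7)+12x^2$.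
   Context: The Pochhammer symbol is $(x)_m:=\Gamma(x+m)/\Gamma(x)$, i.e. $(x)_m=x(x+1)\cdots(x+m-1)$ for integers $m\ge 0$ (with $(x)_0=1$). The reciprocal gamma function $1/\Gamma$ is entire, with value $0$ at the nonpositive integers. *)

theory Defs
  imports "HOL-Analysis.Analysis"
begin

definition P :: "nat \<Rightarrow> complex \<Rightarrow> complex" where
  "P n x = (2 * of_nat n + 1) * (86 * of_nat n + 19) + 4 * x * (20 * of_nat n + 7) + 12 * x ^ 2"

end

theory Submission
  imports Defs
begin

text \<open>
  Write $S(x)$ for the sum of either series. Its terms $T_n(x)$ satisfy
  $(x+\frac12)^2\,T_n(x+1) - x(x+1)\,T_n(x) = G_{n+1}(x) - G_n(x)$ for an explicit WZ mate
  with $G_0(x) = 0$ and $G_n(x) \to 0$, so that $S(x) = \frac{(x+1/2)^2}{x(x+1)}\,S(x+1)$.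
  Iterating, $S(x) = \frac{(x+1/2)_N^2}{(x)_N (x+1)_N}\,S(x+N)$. As $N \to \infty$ the prefactor
  tends to the Gamma quotient by Gauss' product, and Tannery's theorem evaluates the limit of
  $S(x+N)$ as a value of the arcsine series: $2\arcsin 1$ and $24\arcsin\frac12$ respectively.
\<close>

section \<open>Normalised central binomial coefficients and the arcsine series\<close>

definition cbc :: "nat \<Rightarrow> real" where
  "cbc n = of_nat ((2 * n) choose n) / 4 ^ n"

lemma cbc_0 [simp]: "cbc 0 = 1"
  by (simp add: cbc_def)

lemma cbc_Suc: "cbc (Suc n) = cbc n * ((2 * real n + 1) / (2 * real n + 2))"
proof -
  have "real ((2 * n) choose n) = fact (2 * n) / (fact n * fact n)" for n
    by (subst binomial_fact) (auto simp: mult_2)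
  note * = this[of n] this[of "Suc n"]
  show ?thesis
    unfolding cbc_def * by (simp add: divide_simps) (simp add: algebra_simps)
qed

lemma cbc_pos: "cbc n > 0"
  by (simp add: cbc_def)

text \<open>Both sides satisfy the same first-order recurrence in n. This identifies
  \<open>cbc n\<close> as the coefficient of y^n in (1 - y)^(-1/2), so that the general binomial
  series applies.\<close>

lemma cbc_gbinomial: "cbc n = ((-1/2) gchoose n) * (-1) ^ n"
proof (induction n)
  case (Suc n)
  have *: "((-1/2 :: real) gchoose Suc n) = ((-1/2) gchoose n) * ((-1/2 - real n) / (real n + 1))"
    by (simp add: gbinomial_prod_rev field_simps)
  show ?case
    unfolding cbc_Suc Suc.IH * by (simp add: divide_simps) (simp add: algebra_simps)
qed auto

lemma cbc_sums:
  assumes "\<bar>y\<bar> < 1"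
  shows "(\<lambda>n. cbc n * y ^ n) sums (1 / sqrt (1 - y))"
proof -
  have "(\<lambda>n. ((-1/2) gchoose n) * (- y) ^ n) sums ((1 + (- y)) powr (-1/2))"
    using assms by (intro gen_binomial_real) auto
  moreover have "(1 + (- y)) powr (-1/2) = 1 / sqrt (1 - y)"
    using assms powr_minus_divide[of "1 - y" "1/2"] by (simp add: powr_half_sqrt)
  ultimately show ?thesis
    by (simp add: cbc_gbinomial power_minus[of y] mult_ac)
qed

text \<open>The quantity (cbc n)^2 (2n + 1) starts at 1 and does not increase, because (2n + 1)(2n +
  3) <= (2n + 2)^2. The bound serves only to show that \<open>cbc\<close> tends to 0.\<close>

lemma cbc_le_sqrt: "cbc n \<le> 1 / sqrt (2 * real n + 1)"
proof -
  have "(cbc n)\<^sup>2 * (2 * real n + 1) \<le> 1"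
  proof (induction n)
    case (Suc n)
    have "(cbc (Suc n))\<^sup>2 * (2 * real (Suc n) + 1) =
          ((cbc n)\<^sup>2 * (2 * real n + 1)) * ((2 * real n + 1) * (2 * real n + 3) / (2 * real n + 2)\<^sup>2)"
      by (simp add: cbc_Suc power2_eq_square field_simps)
    also have "\<dots> \<le> 1 * 1"
    proof (rule mult_mono)
      show "(2 * real n + 1) * (2 * real n + 3) / (2 * real n + 2)\<^sup>2 \<le> 1"
        by (intro divide_le_eq_1_pos[THEN iffD2] zero_less_power)
           (auto simp: power2_eq_square algebra_simps)
    qed (use Suc in auto)
    finally show ?case by simp
  qed auto
  hence "(cbc n)\<^sup>2 \<le> 1 / (2 * real n + 1)"
    by (simp add: field_simps)
  hence "cbc n \<le> sqrt (1 / (2 * real n + 1))"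
    by (rule real_le_rsqrt)
  thus ?thesis by (simp add: real_sqrt_divide)
qed

lemma cbc_tendsto_0: "cbc \<longlonglongrightarrow> 0"
proof (rule tendsto_sandwich[where f = "\<lambda>_. 0"])
  show "(\<lambda>n. 1 / sqrt (2 * real n + 1)) \<longlonglongrightarrow> 0"
    by (intro tendsto_divide_0[OF tendsto_const] filterlim_at_top_imp_at_infinity
          filterlim_compose[OF sqrt_at_top] filterlim_at_top_mono[OF filterlim_real_sequentially]) auto
qed (use cbc_pos cbc_le_sqrt in \<open>auto intro: always_eventually less_imp_le\<close>)

lemma cbc_le_1: "cbc n \<le> 1"
proof (induction n)
  case (Suc n)
  have "cbc (Suc n) \<le> 1 * 1"
    unfolding cbc_Suc using Suc by (intro mult_mono) auto
  thus ?case by simp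
qed auto

text \<open>Telescoping majorant: cbc n - cbc (n + 1) = cbc n / (2n + 2), and twice this is cbc n /
  (n + 1), which is at least cbc n / (2n + 1).\<close>

lemma summable_cbc: "summable (\<lambda>n. cbc n / (2 * real n + 1))"
proof (rule summable_comparison_test')
  show "summable (\<lambda>n. 2 * (cbc n - cbc (Suc n)))"
    by (intro summable_mult telescope_summable'[OF cbc_tendsto_0])
  show "norm (cbc n / (2 * real n + 1)) \<le> 2 * (cbc n - cbc (Suc n))" for n
    using cbc_pos[of n] by (simp add: cbc_Suc divide_simps) (simp add: algebra_simps)
qed

text \<open>The derivative series is the binomial series of 1 / sqrt (1 - y^2). The endpoint y = 1,
  needed for the first identity, is reached through continuity of the sum on the closed interval;
  the second identity uses y = 1/2.\<close>

lemma arcsin_sums: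
  assumes "0 \<le> y" "y \<le> 1"
  shows "(\<lambda>n. cbc n / (2 * real n + 1) * y ^ (2 * n + 1)) sums arcsin y"
proof -
  define f where "f = (\<lambda>n y. cbc n / (2 * real n + 1) * y ^ (2 * n + 1))"
  define g where "g = (\<lambda>y. \<Sum>n. f n y)"
  \<comment> \<open>A majorant independent of y, summable by \<open>summable_cbc\<close>: the
    Weierstrass test then covers all of [0, 1], including y = 1.\<close>
  have f_le: "norm (f n y) \<le> cbc n / (2 * real n + 1)" if "y \<in> {0..1}" for n y
    using that cbc_pos[of n] power_le_one[of y "2 * n + 1"]
    by (auto simp: f_def abs_mult divide_simps mult_left_le)
  have sm: "summable (\<lambda>n. f n y)" if "y \<in> {0..1}" for y
    using f_le[OF that] by (intro summable_comparison_test'[OF summable_cbc]) auto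
  have cont: "continuous_on {0..1} g"
    unfolding g_def
  proof (rule uniform_limit_theorem)
    show "uniform_limit {0..1} (\<lambda>n x. \<Sum>i<n. f i x) (\<lambda>y. \<Sum>n. f n y) sequentially"
      using f_le summable_cbc by (rule Weierstrass_m_test)
  qed (auto simp: f_def intro!: always_eventually continuous_intros)
  have deriv: "(g has_field_derivative (1 / sqrt (1 - y\<^sup>2))) (at y)" if y: "0 < y" "y < 1" for y
  proof -
    \<comment> \<open>Staying below r < 1 gives the derivative series the geometric majorant
      (r^2)^n, hence uniform convergence on {-r..r}.\<close>
    obtain r where r: "y < r" "r < 1" using y dense by blast
    have r2: "0 \<le> r\<^sup>2" "r\<^sup>2 < 1"
      using r y by (auto simp: power2_eq_square intro: mult_strict_mono[of r 1 r 1, simplified])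
    have "((\<lambda>y. \<Sum>n. f n y) has_field_derivative (\<Sum>n. cbc n * (y\<^sup>2) ^ n)) (at y)"
    proof (rule has_field_derivative_series')
      show "(f n has_field_derivative cbc n * (z\<^sup>2) ^ n) (at z within {-r..r})" for n z
        unfolding f_def
        by (rule derivative_eq_intros refl)+ (simp add: field_simps flip: power_mult)
      show "uniformly_convergent_on {-r..r} (\<lambda>n x. \<Sum>i<n. cbc i * (x\<^sup>2) ^ i)"
      proof (rule Weierstrass_m_test')
        show "norm (cbc n * (x\<^sup>2) ^ n) \<le> (r\<^sup>2) ^ n" if "x \<in> {-r..r}" for n x
        proof -
          have "x\<^sup>2 \<le> r\<^sup>2" using that by (subst abs_le_square_iff [symmetric]) auto
          hence "(x\<^sup>2) ^ n \<le> (r\<^sup>2) ^ n" by (rule power_mono) auto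
          with cbc_le_1[of n] have "cbc n * (x\<^sup>2) ^ n \<le> 1 * (r\<^sup>2) ^ n"
            by (intro mult_mono) auto
          thus ?thesis using cbc_pos[of n] by (simp add: abs_mult)
        qed
        show "summable (\<lambda>n. (r\<^sup>2) ^ n)" using r2 by (intro summable_geometric) auto
      qed
      show "summable (\<lambda>n. f n y)" using y by (intro sm) auto
    qed (use r y in \<open>auto simp: interior_atLeastAtMost_real\<close>)
    moreover have "\<bar>y\<^sup>2\<bar> < 1"
      using y r r2 by (smt (verit) power_strict_mono zero_le_power2 pos2)
    ultimately show ?thesis
      using sums_unique[OF cbc_sums[of "y\<^sup>2"]] by (simp add: g_def)
  qed
  \<comment> \<open>A function continuous on [0, 1] with zero derivative inside is constant;
    differentiability at the endpoints does not enter.\<close>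
  have "(g y - arcsin y) = g 0 - arcsin 0"
  proof (cases "y = 0")
    case False
    have "((\<lambda>y. g y - arcsin y) has_field_derivative 0) (at z)" if "0 < z" "z < 1" for z
      using that by (auto intro!: derivative_eq_intros deriv[OF that] simp: divide_inverse)
    moreover have "continuous_on {0..1} (\<lambda>y. g y - arcsin y)"
      by (intro continuous_intros cont) auto
    ultimately show ?thesis
      using DERIV_isconst2[of 0 1 "\<lambda>y. g y - arcsin y" y] assms by auto
  qed auto
  moreover have "g 0 = 0" by (simp add: g_def f_def)
  ultimately have "g y = arcsin y" by simp
  thus ?thesis
    using summable_sums[OF sm[of y]] assms by (simp add: g_def f_def)
qed

section \<open>Summation by a shift recurrence\<close>

text \<open>Both sides are \<open>pochhammer a (Suc n)\<close>, with the first or the last factor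
  split off.\<close>

lemma pochhammer_shift:
  fixes a :: "'a :: comm_ring_1"
  shows "a * pochhammer (a + 1) n = (a + of_nat n) * pochhammer a n"
  by (metis pochhammer_rec pochhammer_rec')

lemma nonpos_Ints_neqs:
  fixes x :: complex
  assumes "x \<notin> \<int>\<^sub>\<le>\<^sub>0"
  shows "x + of_nat k \<noteq> 0" "of_nat k + x \<noteq> 0" "x + of_nat k \<notin> \<int>\<^sub>\<le>\<^sub>0"
proof -
  show *: "x + of_nat k \<noteq> 0"
    using assms plus_of_nat_eq_0_imp by blast
  thus "of_nat k + x \<noteq> 0" by (simp add: add.commute)
  show "x + of_nat k \<notin> \<int>\<^sub>\<le>\<^sub>0"
    using assms by (metis add_diff_cancel_right' nonpos_Ints_diff_Nats of_nat_in_Nats)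
qed

text \<open>In the product of the Gauss sequences for Gamma x, Gamma (x + 1) and 1 / Gamma (x +
  1/2)^2 the factorials cancel, and so do the powers of n, because x + (x + 1) = 2 (x +
  1/2).\<close>

lemma pochhammer_quotient_tendsto_Gamma:
  fixes x :: complex
  assumes "x \<notin> \<int>\<^sub>\<le>\<^sub>0"
  shows "(\<lambda>n. (pochhammer (x + 1/2) n)\<^sup>2 / (pochhammer x n * pochhammer (x + 1) n))
           \<longlonglongrightarrow> Gamma x * Gamma (x + 1) * rGamma (x + 1/2) ^ 2"
\<comment> \<open>The n-th Gauss term contains Pochhammer symbols of length n + 1, hence the
  offset.\<close>
proof (rule LIMSEQ_offset[of _ 1])
  have "(\<lambda>n. Gamma_series x n * Gamma_series (x + 1) n * rGamma_series (x + 1/2) n ^ 2)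
           \<longlonglongrightarrow> Gamma x * Gamma (x + 1) * rGamma (x + 1/2) ^ 2"
    by (intro tendsto_intros)
  moreover have "Gamma_series x n * Gamma_series (x + 1) n * rGamma_series (x + 1/2) n ^ 2 =
      (pochhammer (x + 1/2) (n + 1))\<^sup>2 / (pochhammer x (n + 1) * pochhammer (x + 1) (n + 1))" for n
  proof -
    define l :: complex where "l = of_real (ln (of_nat n))"
    have "exp ((x + 1/2) * l) ^ 2 = exp (x * l) * exp ((x + 1) * l)"
      by (simp add: power2_eq_square exp_add [symmetric] algebra_simps)
    thus ?thesis
      by (simp add: Gamma_series_def rGamma_series_def power_divide power_mult_distrib flip: l_def)
         (simp add: power2_eq_square)
  qed
  ultimately show "(\<lambda>n. (pochhammer (x + 1/2) (n + 1))\<^sup>2 /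
      (pochhammer x (n + 1) * pochhammer (x + 1) (n + 1)))
           \<longlonglongrightarrow> Gamma x * Gamma (x + 1) * rGamma (x + 1/2) ^ 2"
    by simp
qed

lemma filterlim_shift_at_infinity: "filterlim (\<lambda>N. x + of_nat N :: complex) at_infinity sequentially"
  using tendsto_add_filterlim_at_infinity[OF tendsto_const tendsto_of_nat] .

text \<open>The argument common to both series. The majorant \<open>M\<close> is required only for
  Re z >= 1; convergence at a general x is pulled back from x + N with N large. \<open>L\<close>
  collects the termwise limits as the parameter tends to infinity, and its sum \<open>c\<close>
  becomes the constant in front of the Gamma quotient.\<close>

lemma sums_by_WZ_shift:
  fixes T G :: "nat \<Rightarrow> complex \<Rightarrow> complex" and M :: "nat \<Rightarrow> real"
  assumes WZ: "\<And>x n. x \<notin> \<int>\<^sub>\<le>\<^sub>0 \<Longrightarrow>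
      (x + 1/2)\<^sup>2 * T n (x + 1) - x * (x + 1) * T n x = G (Suc n) x - G n x"
    and G_0: "\<And>x. G 0 x = 0"
    and G_lim: "\<And>x. x \<notin> \<int>\<^sub>\<le>\<^sub>0 \<Longrightarrow> (\<lambda>n. G n x) \<longlonglongrightarrow> 0"
    and bound: "\<And>n z. Re z \<ge> 1 \<Longrightarrow> norm (T n z) \<le> M n"
    and M: "summable M"
    and T_lim: "\<And>n. (T n \<longlongrightarrow> L n) at_infinity"
    and L: "L sums c"
    and x: "x \<notin> \<int>\<^sub>\<le>\<^sub>0"
  shows "(\<lambda>n. T n x) sums (c * (Gamma x * Gamma (x + 1) * rGamma (x + 1/2) ^ 2))"
proof -
  \<comment> \<open>Summing the WZ relation over n telescopes to 0, since the mate vanishes at n = 0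
    and in the limit. Convergence passes from x + 1 down to x.\<close>
  have step: "(\<lambda>n. T n x) sums ((x + 1/2)\<^sup>2 / (x * (x + 1)) * s)"
    if sums: "(\<lambda>n. T n (x + 1)) sums s" and x: "x \<notin> \<int>\<^sub>\<le>\<^sub>0" for x s
  proof -
    have nz: "x \<noteq> 0" "x + 1 \<noteq> 0"
      using nonpos_Ints_neqs(1)[OF x, of 0] nonpos_Ints_neqs(1)[OF x, of 1] by auto
    have "(\<lambda>n. (G (Suc n) x - G n x)) sums (0 - G 0 x)"
      by (rule telescope_sums[OF G_lim[OF x]])
    hence "(\<lambda>n. ((x + 1/2)\<^sup>2 * T n (x + 1) - (G (Suc n) x - G n x)) / (x * (x + 1)))
             sums (((x + 1/2)\<^sup>2 * s - 0) / (x * (x + 1)))"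
      using sums by (intro sums_divide sums_diff sums_mult) (auto simp: G_0)
    moreover have "((x + 1/2)\<^sup>2 * T n (x + 1) - (G (Suc n) x - G n x)) / (x * (x + 1)) = T n x" for n
      unfolding WZ[OF x, symmetric] using nz by simp
    ultimately show ?thesis by simp
  qed
  define Q where "Q N = (pochhammer (x + 1/2) N)\<^sup>2 / (pochhammer x N * pochhammer (x + 1) N)" for N
  have iter: "(\<lambda>n. T n x) sums (Q N * s)" if "(\<lambda>n. T n (x + of_nat N)) sums s" for N s
    using that
  proof (induction N arbitrary: s)
    case (Suc N)
    have "(\<lambda>n. T n (x + of_nat N)) sums
        ((x + of_nat N + 1/2)\<^sup>2 / ((x + of_nat N) * (x + of_nat N + 1)) * s)"
      by (rule step) (use Suc.prems nonpos_Ints_neqs[OF x] in \<open>auto simp: add_ac\<close>)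
    from Suc.IH[OF this] show ?case
      by (simp add: Q_def pochhammer_Suc power_mult_distrib add_ac mult_ac)
  qed (simp add: Q_def)
  define S where "S N = (\<Sum>n. T n (x + of_nat N))" for N
  have Re_ge: "eventually (\<lambda>N. Re (x + of_nat N) \<ge> 1) sequentially"
    using eventually_ge_at_top[of "nat \<lceil>1 - Re x\<rceil>"] by eventually_elim (simp; linarith)
  have "S \<longlonglongrightarrow> suminf L"
    unfolding S_def
  proof (intro tannerys_theorem[THEN conjunct2, THEN conjunct2] M)
    show "(\<lambda>N. T n (x + of_nat N)) \<longlonglongrightarrow> L n" for n
      using filterlim_compose[OF T_lim filterlim_shift_at_infinity] .
    \<comment> \<open>Only N has to be large: once Re (x + N) >= 1, the bound holds for every n at
      once.\<close>
    show "\<forall>\<^sub>F (n, N) in sequentially \<times>\<^sub>F sequentially. norm (T n (x + of_nat N)) \<le> M n"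
      using Re_ge by (subst eventually_prod_filter)
        (auto intro!: exI[of _ "\<lambda>_. True"] exI[of _ "\<lambda>N. Re (x + of_nat N) \<ge> 1"] bound)
  qed (use M in auto)
  hence S_lim: "S \<longlonglongrightarrow> c"
    using L by (simp add: sums_iff)
  have sums_S: "(\<lambda>n. T n x) sums (Q N * S N)" if "Re (x + of_nat N) \<ge> 1" for N
    unfolding S_def using bound[OF that]
    by (intro iter summable_sums summable_comparison_test'[OF M])
  \<comment> \<open>The product does not depend on N once N is large, so its limit is the sum
    sought.\<close>
  have "eventually (\<lambda>N. Q N * S N = (\<Sum>n. T n x)) sequentially"
    using Re_ge by eventually_elim (use sums_S in \<open>auto simp: sums_iff\<close>)
  moreover have "(\<lambda>N. Q N * S N) \<longlonglongrightarrow> (Gamma x * Gamma (x + 1) * rGamma (x + 1/2) ^ 2) * c"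
    unfolding Q_def by (intro tendsto_mult pochhammer_quotient_tendsto_Gamma x S_lim)
  ultimately have "(\<lambda>N :: nat. \<Sum>n. T n x) \<longlonglongrightarrow> (Gamma x * Gamma (x + 1) * rGamma (x + 1/2) ^ 2) * c"
    using tendsto_cong by fast
  hence "(\<Sum>n. T n x) = c * (Gamma x * Gamma (x + 1) * rGamma (x + 1/2) ^ 2)"
    by (simp add: LIMSEQ_const_iff mult.commute)
  moreover obtain N where "Re (x + of_nat N) \<ge> 1"
    using Re_ge by (auto simp: eventually_sequentially)
  ultimately show ?thesis
    using sums_S[of N] by (metis sums_unique)
qed

section \<open>The two hypergeometric terms\<close>

definition H1 :: "nat \<Rightarrow> complex \<Rightarrow> complex" where
  "H1 n x = pochhammer (1/2 + x) n / pochhammer (1 + x) n * of_real (cbc n)"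

definition T1 :: "nat \<Rightarrow> complex \<Rightarrow> complex" where
  "T1 n x = (4 * of_nat n + 2 * x + 1) / ((2 * of_nat n + 1) * (of_nat n + x)) * H1 n x"

text \<open>The power 2^(6n) of the series is split as 4^n, absorbed in \<open>cbc n\<close>, times
  16^n.\<close>

definition H2 :: "nat \<Rightarrow> complex \<Rightarrow> complex" where
  "H2 n x = (pochhammer (1/2 + x) n)\<^sup>2 / (pochhammer (1 + x/2) n * pochhammer ((1 + x)/2) n) *
              of_real (cbc n) / 16 ^ n"

definition T2 :: "nat \<Rightarrow> complex \<Rightarrow> complex" where
  "T2 n x = (2 * (2 * of_nat n + 1) ^ 2 * (15 * of_nat n + 2) + x * P n x)
               / ((2 * of_nat n + 1) * (2 * of_nat n + x) * (2 * of_nat n + x + 1) ^ 2) * H2 n x"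

lemma two_of_nat_plus_neqs:
  fixes x :: complex
  assumes "x \<notin> \<int>\<^sub>\<le>\<^sub>0"
  shows "2 * of_nat n + x \<noteq> 0" "2 * of_nat n + x + 1 \<noteq> 0"
        "2 * of_nat n + x + 2 \<noteq> 0" "2 * of_nat n + x + 3 \<noteq> 0"
  using nonpos_Ints_neqs(1)[OF assms, of "2 * n"] nonpos_Ints_neqs(1)[OF assms, of "2 * n + 1"]
    nonpos_Ints_neqs(1)[OF assms, of "2 * n + 2"] nonpos_Ints_neqs(1)[OF assms, of "2 * n + 3"]
  by (simp_all add: add_ac)

lemma of_nat_odd_neq: "2 * of_nat n + 1 \<noteq> (0 :: complex)"
  using of_nat_neq_0[of "2 * n", where 'a = complex] by (simp add: add.commute)

lemma of_nat_even_neq: "2 * of_nat n + 2 \<noteq> (0 :: complex)"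
  using of_nat_neq_0[of "2 * n + 1", where 'a = complex] by (simp add: add.commute)

lemma H1_0 [simp]: "H1 0 x = 1"
  and H2_0 [simp]: "H2 0 x = 1"
  by (simp_all add: H1_def H2_def)

text \<open>Valid for every complex x: where x + 1 + n = 0, both sides are 0, since division by 0
  yields 0. The same convention covers \<open>H2_Suc\<close>.\<close>

lemma H1_Suc:
  "H1 (Suc n) x = H1 n x * ((x + 1/2 + of_nat n) / (x + 1 + of_nat n)) *
                    ((2 * of_nat n + 1) / (2 * of_nat n + 2))"
  by (simp add: H1_def pochhammer_Suc cbc_Suc add_ac)

lemma H2_Suc:
  "H2 (Suc n) x = H2 n x *
     (4 * (x + 1/2 + of_nat n)\<^sup>2 / ((2 * of_nat n + x + 2) * (2 * of_nat n + x + 1))) *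
     ((2 * of_nat n + 1) / (2 * of_nat n + 2)) / 16"
proof -
  have *: "1 + x/2 + of_nat n = (2 * of_nat n + x + 2) / 2"
          "(1 + x)/2 + of_nat n = (2 * of_nat n + x + 1) / 2"
    by (simp_all add: field_simps)
  show ?thesis
    unfolding H2_def pochhammer_Suc * cbc_Suc
    by (simp add: power_mult_distrib add_ac mult_ac)
qed

lemma H1_shift:
  assumes "x \<notin> \<int>\<^sub>\<le>\<^sub>0"
  shows "(x + 1/2) * H1 n (x + 1) =
           (x + 1/2 + of_nat n) * (x + 1) / (of_nat n + x + 1) * H1 n x"
proof -
  have nz: "x + 1 \<noteq> 0" "of_nat n + x + 1 \<noteq> 0"
    using nonpos_Ints_neqs(1)[OF assms, of 1] nonpos_Ints_neqs(1)[OF assms, of "n + 1"]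
    by (simp_all add: add_ac)
  have A: "(x + 1/2) * pochhammer (1/2 + (x + 1)) n = (x + 1/2 + of_nat n) * pochhammer (1/2 + x) n"
    using pochhammer_shift[of "1/2 + x" n] by (simp add: add_ac)
  have B: "pochhammer (1 + (x + 1)) n = (of_nat n + x + 1) * pochhammer (1 + x) n / (x + 1)"
    using pochhammer_shift[of "1 + x" n] nz by (simp add: field_simps)
  have "(x + 1/2) * H1 n (x + 1) =
          ((x + 1/2) * pochhammer (1/2 + (x + 1)) n) / pochhammer (1 + (x + 1)) n * of_real (cbc n)"
    by (simp add: H1_def)
  also have "\<dots> = (x + 1/2 + of_nat n) * (x + 1) / (of_nat n + x + 1) * H1 n x"
    unfolding A B by (simp add: H1_def)
  finally show ?thesis .
qed

text \<open>Passing from x to x + 1 interchanges the two denominator parameters up to a unit: (1 +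
  x)/2 becomes 1 + x/2, while 1 + x/2 becomes (1 + x)/2 + 1. Hence only one denominator symbol
  contributes a factor.\<close>

lemma H2_shift:
  assumes "x \<notin> \<int>\<^sub>\<le>\<^sub>0"
  shows "(x + 1/2)\<^sup>2 * H2 n (x + 1) =
           (x + 1/2 + of_nat n)\<^sup>2 * (x + 1) / (2 * of_nat n + x + 1) * H2 n x"
proof -
  have nz: "x + 1 \<noteq> 0" "2 * of_nat n + x + 1 \<noteq> 0"
    using nonpos_Ints_neqs(1)[OF assms, of 1] two_of_nat_plus_neqs[OF assms, of n] by simp_all
  have A: "(x + 1/2) * pochhammer (1/2 + (x + 1)) n = (x + 1/2 + of_nat n) * pochhammer (1/2 + x) n"
    using pochhammer_shift[of "1/2 + x" n] by (simp add: add_ac)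
  have B: "pochhammer (1 + (x + 1)/2) n =
      (2 * of_nat n + x + 1) * pochhammer ((1 + x)/2) n / (x + 1)"
  proof -
    define X where "X = pochhammer (1 + (x + 1)/2) n"
    define Y where "Y = pochhammer ((1 + x)/2) n"
    have "(x + 1) * X = 2 * ((1 + x)/2 * X)"
      by simp
    also have "(1 + x)/2 * X = ((1 + x)/2 + of_nat n) * Y"
      using pochhammer_shift[of "(1 + x)/2" n] by (simp add: X_def Y_def add_ac)
    also have "2 * \<dots> = (2 * of_nat n + x + 1) * Y"
      by (simp add: algebra_simps)
    finally show ?thesis
      using nz by (simp add: X_def Y_def field_simps)
  qed
  have C: "(1 + (x + 1))/2 = 1 + x/2"
    by (simp add: field_simps)
  have "(x + 1/2)\<^sup>2 * H2 n (x + 1) = ((x + 1/2) * pochhammer (1/2 + (x + 1)) n)\<^sup>2 /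
      (pochhammer (1 + (x + 1)/2) n * pochhammer ((1 + (x + 1))/2) n) * of_real (cbc n) / 16 ^ n"
    by (simp add: H2_def power_mult_distrib)
  also have "\<dots> = (x + 1/2 + of_nat n)\<^sup>2 * (x + 1) / (2 * of_nat n + x + 1) * H2 n x"
    unfolding A B C by (simp add: H2_def power_mult_distrib mult_ac)
  finally show ?thesis .
qed

section \<open>WZ pairs for the two terms\<close>

text \<open>By \<open>H1_shift\<close> and \<open>H1_Suc\<close> each of the four terms is a
  rational function of n and x times \<open>H1 n x\<close>, so the claim reduces to an identity of
  rational functions.\<close>

lemma WZ_T1:
  fixes x :: complex
  assumes "x \<notin> \<int>\<^sub>\<le>\<^sub>0"
  defines "G \<equiv> \<lambda>n. - (x + 1) * of_nat n / (of_nat n + x) * H1 n x"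
  shows "(x + 1/2)\<^sup>2 * T1 n (x + 1) - x * (x + 1) * T1 n x = G (Suc n) - G n"
proof -
  define m :: complex where "m = of_nat n"
  have nz: "m + x \<noteq> 0" "m + x + 1 \<noteq> 0" "2 * m + 1 \<noteq> 0" "2 * m + 2 \<noteq> 0"
    using nonpos_Ints_neqs(2)[OF assms(1), of n] nonpos_Ints_neqs(2)[OF assms(1), of "n + 1"]
      of_nat_odd_neq[of n] of_nat_even_neq[of n]
    by (simp_all add: m_def add_ac)
  \<comment> \<open>\<open>?A\<close> to \<open>?D\<close> are the coefficients of
    \<open>H1 n x\<close> in the four terms. \<open>?A\<close> keeps one factor x + 1/2, as
    \<open>H1_shift\<close> absorbs only the other.\<close>
  have "(x + 1/2) * ((4 * m + 2 * (x + 1) + 1) / ((2 * m + 1) * (m + x + 1))) *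
          ((x + 1/2 + m) * (x + 1) / (m + x + 1)) -
        x * (x + 1) * ((4 * m + 2 * x + 1) / ((2 * m + 1) * (m + x))) =
        - (x + 1) * (m + 1) / (m + x + 1) *
          (((x + 1/2 + m) / (m + x + 1)) * ((2 * m + 1) / (2 * m + 2))) -
        (- (x + 1) * m / (m + x))"
    (is "?A - ?B = ?C - ?D")
    using nz by (simp add: divide_simps) algebra
  hence "?A * H1 n x - ?B * H1 n x = ?C * H1 n x - ?D * H1 n x"
    by (metis left_diff_distrib)
  moreover have "(x + 1/2)\<^sup>2 * T1 n (x + 1) = ?A * H1 n x"
  proof -
    have "(x + 1/2)\<^sup>2 * T1 n (x + 1) =
        (x + 1/2) * ((4 * m + 2 * (x + 1) + 1) / ((2 * m + 1) * (m + x + 1))) *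
          ((x + 1/2) * H1 n (x + 1))"
      by (simp add: T1_def power2_eq_square m_def add_ac mult_ac)
    also have "\<dots> = ?A * H1 n x"
      unfolding H1_shift[OF assms(1)] m_def by (simp add: mult_ac)
    finally show ?thesis .
  qed
  moreover have "x * (x + 1) * T1 n x = ?B * H1 n x"
    by (simp add: T1_def m_def mult_ac)
  moreover have "G (Suc n) = ?C * H1 n x"
    unfolding G_def H1_Suc m_def by (simp add: add_ac mult_ac)
  moreover have "G n = ?D * H1 n x"
    by (simp add: G_def m_def)
  ultimately show ?thesis by simp
qed

lemma WZ_T2:
  fixes x :: complex
  assumes "x \<notin> \<int>\<^sub>\<le>\<^sub>0"
  defines "G \<equiv> \<lambda>n. - 8 * (x + 1) * of_nat n / (2 * of_nat n + x) * H2 n x"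
  shows "(x + 1/2)\<^sup>2 * T2 n (x + 1) - x * (x + 1) * T2 n x = G (Suc n) - G n"
proof -
  define m :: complex where "m = of_nat n"
  define u where "u = 2 * m + x"
  have nz: "u \<noteq> 0" "u + 1 \<noteq> 0" "u + 2 \<noteq> 0" "2 * m + 1 \<noteq> 0" "2 * m + 2 \<noteq> 0"
    using two_of_nat_plus_neqs[OF assms(1), of n] of_nat_odd_neq[of n] of_nat_even_neq[of n]
    by (simp_all add: m_def u_def)
  define A where "A = 2 * (2 * m + 1)\<^sup>2 * (15 * m + 2) + x * P n x"
  define A' where "A' = 2 * (2 * m + 1)\<^sup>2 * (15 * m + 2) + (x + 1) * P n (x + 1)"
  \<comment> \<open>Here \<open>H2_shift\<close> absorbs both factors x + 1/2. The numerators
    \<open>A\<close> and \<open>A'\<close> stay folded while denominators are cleared and are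
    expanded only for the final polynomial identity.\<close>
  have "A' / ((2 * m + 1) * (u + 1) * (u + 2)\<^sup>2) *
          ((x + 1/2 + m)\<^sup>2 * (x + 1) / (u + 1)) -
        x * (x + 1) * (A / ((2 * m + 1) * u * (u + 1)\<^sup>2)) =
        - 8 * (x + 1) * (m + 1) / (u + 2) *
          ((4 * (x + 1/2 + m)\<^sup>2 / ((u + 2) * (u + 1))) *
           ((2 * m + 1) / (2 * m + 2)) / 16) -
        (- 8 * (x + 1) * m / u)"
    (is "?A - ?B = ?C - ?D")
    using nz
    by (simp add: divide_simps) (unfold A_def A'_def u_def P_def m_def [symmetric], algebra)
  hence "?A * H2 n x - ?B * H2 n x = ?C * H2 n x - ?D * H2 n x"
    by (metis left_diff_distrib)
  moreover have "(x + 1/2)\<^sup>2 * T2 n (x + 1) = ?A * H2 n x"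
  proof -
    have "(x + 1/2)\<^sup>2 * T2 n (x + 1) =
        A' / ((2 * m + 1) * (u + 1) * (u + 2)\<^sup>2) * ((x + 1/2)\<^sup>2 * H2 n (x + 1))"
      by (simp add: T2_def A'_def u_def m_def add_ac mult_ac)
    also have "\<dots> = ?A * H2 n x"
      unfolding H2_shift[OF assms(1)] u_def m_def by (simp add: mult_ac)
    finally show ?thesis .
  qed
  moreover have "x * (x + 1) * T2 n x = ?B * H2 n x"
    by (simp add: T2_def A_def u_def m_def mult_ac)
  moreover have "G (Suc n) = ?C * H2 n x"
    unfolding G_def H2_Suc u_def m_def by (simp add: add_ac mult_ac)
  moreover have "G n = ?D * H2 n x"
    by (simp add: G_def u_def m_def)
  ultimately show ?thesis by simp
qed

section \<open>Bounds and limits of the terms\<close>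

lemma norm_add_of_real_mono:
  fixes w :: complex
  assumes "Re w \<ge> 0" "0 \<le> a" "a \<le> b"
  shows "norm (w + of_real a) \<le> norm (w + of_real b)"
proof -
  have "(Re w + a)\<^sup>2 \<le> (Re w + b)\<^sup>2"
    using assms by (intro power_mono) auto
  thus ?thesis by (simp add: cmod_def)
qed

lemma norm_of_nat_odd: "norm (2 * of_nat n + 1 :: complex) = 2 * real n + 1"
proof -
  have "2 * of_nat n + 1 = (of_real (2 * real n + 1) :: complex)"
    by simp
  thus ?thesis by (simp only: norm_of_real)
qed

lemma norm_odd_even_quotient:
  "norm ((2 * of_nat n + 1) / (2 * of_nat n + 2) :: complex) = (2 * real n + 1) / (2 * real n + 2)"
proof -
  have "(2 * of_nat n + 1) / (2 * of_nat n + 2) =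
          (of_real ((2 * real n + 1) / (2 * real n + 2)) :: complex)"
    by simp
  thus ?thesis by (simp only: norm_of_real) simp
qed

text \<open>From index k on, x + n lies in the closed right half-plane, where |x + n + 1/2| <= |x +
  n + 1|. So |H1 n x| / cbc n does not increase.\<close>

lemma H1_bound:
  assumes "Re x + real k \<ge> 0" "n \<ge> k"
  shows "norm (H1 n x) \<le> norm (H1 k x) / cbc k * cbc n"
  using assms(2)
proof (induction n rule: nat_induct_at_least)
  case base
  show ?case using cbc_pos[of k] by simp
next
  case (Suc n)
  have "norm (x + of_nat n + of_real (1/2)) \<le> norm (x + of_nat n + of_real 1)"
    using assms(1) Suc.hyps by (intro norm_add_of_real_mono) auto
  hence "norm ((x + 1/2 + of_nat n) / (x + 1 + of_nat n)) \<le> 1"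
    by (simp add: norm_divide divide_le_eq_1 add_ac)
  moreover note norm_odd_even_quotient[of n]
  ultimately have "norm (H1 (Suc n) x) \<le> norm (H1 n x) * 1 * ((2 * real n + 1) / (2 * real n + 2))"
    unfolding H1_Suc norm_mult by (intro mult_mono) auto
  also have "\<dots> \<le> norm (H1 k x) / cbc k * cbc n * 1 * ((2 * real n + 1) / (2 * real n + 2))"
    using Suc.IH by (intro mult_right_mono) auto
  finally show ?case by (simp add: cbc_Suc mult_ac)
qed

text \<open>From index k on, consecutive terms shrink by a factor of at most 4/16: the modulus of x
  + n + 1/2 is at most that of each denominator factor, as these arise from x + n by adding n + 2
  and n + 1.\<close>

lemma H2_bound:
  assumes "Re x + real k \<ge> 0" "n \<ge> k"
  shows "norm (H2 n x) \<le> norm (H2 k x) * 4 ^ k / 4 ^ n"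
  using assms(2)
proof (induction n rule: nat_induct_at_least)
  case (Suc n)
  define w where "w = x + 1/2 + of_nat n"
  have "norm (x + of_nat n + of_real (1/2)) \<le> norm (x + of_nat n + of_real (real n + 2))"
       "norm (x + of_nat n + of_real (1/2)) \<le> norm (x + of_nat n + of_real (real n + 1))"
    using assms(1) Suc.hyps by (intro norm_add_of_real_mono; simp)+
  hence w: "norm w \<le> norm (2 * of_nat n + x + 2)" "norm w \<le> norm (2 * of_nat n + x + 1)"
    by (simp_all add: w_def add_ac)
  define N where "N = norm (2 * of_nat n + x + 2) * norm (2 * of_nat n + x + 1)"
  have "norm w * norm w \<le> N"
    using w unfolding N_def by (intro mult_mono) auto
  moreover have "N \<ge> 0"
    by (simp add: N_def)
  ultimately have "norm w * norm w / N \<le> 1"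
    by (cases "N = 0") (auto simp: divide_le_eq_1)
  hence "norm (4 * w\<^sup>2 / ((2 * of_nat n + x + 2) * (2 * of_nat n + x + 1))) \<le> 4"
    by (simp add: norm_divide norm_mult power2_eq_square N_def)
  moreover have "norm ((2 * of_nat n + 1) / (2 * of_nat n + 2) :: complex) \<le> 1"
    unfolding norm_odd_even_quotient by simp
  ultimately have "norm (H2 (Suc n) x) \<le> norm (H2 n x) * 4 * 1 / 16"
    unfolding H2_Suc norm_mult norm_divide[of _ 16] norm_numeral w_def
    by (intro divide_right_mono mult_mono) (auto simp del: times_divide_eq_right)
  also have "\<dots> \<le> (norm (H2 k x) * 4 ^ k / 4 ^ n) * 4 * 1 / 16"
    using Suc.IH by (intro divide_right_mono mult_right_mono) auto
  finally show ?case by simp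
qed auto

lemma H1_tendsto_0: "(\<lambda>n. H1 n x) \<longlonglongrightarrow> 0"
proof -
  define k where "k = nat \<lceil>- Re x\<rceil>"
  have k: "Re x + real k \<ge> 0" unfolding k_def by linarith
  have "eventually (\<lambda>n. norm (H1 n x) \<le> norm (H1 k x) / cbc k * cbc n) sequentially"
    using eventually_ge_at_top[of k] by eventually_elim (rule H1_bound[OF k])
  moreover have "(\<lambda>n. norm (H1 k x) / cbc k * cbc n) \<longlonglongrightarrow> 0"
    by (intro tendsto_mult_right_zero cbc_tendsto_0)
  ultimately show ?thesis by (rule Lim_null_comparison)
qed

lemma H2_tendsto_0: "(\<lambda>n. H2 n x) \<longlonglongrightarrow> 0"
proof -
  define k where "k = nat \<lceil>- Re x\<rceil>"
  have k: "Re x + real k \<ge> 0" unfolding k_def by linarith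
  have "eventually (\<lambda>n. norm (H2 n x) \<le> norm (H2 k x) * 4 ^ k * (1/4) ^ n) sequentially"
    using eventually_ge_at_top[of k]
    by eventually_elim (use H2_bound[OF k] in \<open>simp add: power_divide\<close>)
  moreover have "(\<lambda>n. norm (H2 k x) * 4 ^ k * (1/4) ^ n) \<longlonglongrightarrow> 0"
    by (intro tendsto_mult_right_zero LIMSEQ_power_zero) auto
  ultimately show ?thesis by (rule Lim_null_comparison)
qed

text \<open>Used both for the parameter tending to infinity and, composed with
  \<open>of_nat\<close>, for the index n.\<close>

lemma linear_fraction_tendsto:
  fixes a b c d :: "'a :: real_normed_field"
  assumes "d \<noteq> 0"
  shows "((\<lambda>z. (a + b * z) / (c + d * z)) \<longlongrightarrow> b / d) at_infinity"
proof -
  have "((\<lambda>z. (a * inverse z + b) / (c * inverse z + d)) \<longlongrightarrow> (a * 0 + b) / (c * 0 + d)) at_infinity"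
    using assms by (intro tendsto_intros tendsto_inverse_0) auto
  moreover have "eventually (\<lambda>z. (a * inverse z + b) / (c * inverse z + d) =
      (a + b * z) / (c + d * z)) at_infinity"
    using eventually_not_equal_at_infinity[of 0]
  proof eventually_elim
    case (elim z)
    have "(a + b * z) / (c + d * z) = ((a + b * z) * inverse z) / ((c + d * z) * inverse z)"
      using elim by simp
    thus ?case using elim by (simp add: distrib_right mult.assoc)
  qed
  ultimately show ?thesis
    by (simp add: filterlim_cong)
qed

lemma H1_tendsto_at_infinity: "(H1 n \<longlongrightarrow> of_real (cbc n)) at_infinity"
proof (induction n)
  case (Suc n)
  have "((\<lambda>z. H1 n z * (((1/2 + of_nat n) + 1 * z) / ((1 + of_nat n) + 1 * z)) *
          ((2 * of_nat n + 1) / (2 * of_nat n + 2)))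
        \<longlongrightarrow> of_real (cbc n) * (1 / 1) * ((2 * of_nat n + 1) / (2 * of_nat n + 2))) at_infinity"
    by (intro tendsto_mult Suc linear_fraction_tendsto tendsto_const) auto
  thus ?case
    by (simp add: H1_Suc [abs_def] cbc_Suc add_ac)
qed auto

lemma H2_tendsto_at_infinity: "(H2 n \<longlongrightarrow> of_real (cbc n / 4 ^ n)) at_infinity"
proof (induction n)
  case (Suc n)
  define q :: complex where "q = (2 * of_nat n + 1) / (2 * of_nat n + 2)"
  have lim: "((\<lambda>z. H2 n z * (4 * ((((1/2 + of_nat n) + 1 * z) / ((2 * of_nat n + 2) + 1 * z)) *
                             (((1/2 + of_nat n) + 1 * z) / ((2 * of_nat n + 1) + 1 * z)))) * q / 16)
        \<longlongrightarrow> of_real (cbc n / 4 ^ n) * (4 * ((1 / 1) * (1 / 1))) * q / 16) at_infinity"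
    by (intro tendsto_mult tendsto_divide Suc linear_fraction_tendsto tendsto_const) auto
  have lim_eq: "of_real (cbc n / 4 ^ n) * (4 * ((1 / 1) * (1 / 1))) * q / 16 =
      of_real (cbc (Suc n) / 4 ^ Suc n)"
  proof -
    have "of_real (cbc (Suc n)) = of_real (cbc n) * q"
      by (simp add: cbc_Suc q_def)
    thus ?thesis by simp
  qed
  have fun_eq: "H2 n z * (4 * ((((1/2 + of_nat n) + 1 * z) / ((2 * of_nat n + 2) + 1 * z)) *
      (((1/2 + of_nat n) + 1 * z) / ((2 * of_nat n + 1) + 1 * z)))) * q / 16 = H2 (Suc n) z" for z
    unfolding H2_Suc q_def power2_eq_square by (simp add: add_ac mult_ac)
  show ?case using lim unfolding lim_eq fun_eq .
qed auto

lemma T1_tendsto_at_infinity: "(T1 n \<longlongrightarrow> of_real (2 * (cbc n / (2 * real n + 1)))) at_infinity"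
proof -
  have "((\<lambda>z. 1 / (2 * of_nat n + 1) * (((4 * of_nat n + 1) + 2 * z) / (of_nat n + 1 * z)) * H1 n z)
          \<longlongrightarrow> 1 / (2 * of_nat n + 1) * (2 / 1) * of_real (cbc n)) at_infinity"
    by (intro tendsto_mult H1_tendsto_at_infinity linear_fraction_tendsto tendsto_const) auto
  thus ?thesis
    by (simp add: T1_def [abs_def] add_ac)
qed

lemma T2_tendsto_at_infinity: "(T2 n \<longlongrightarrow> of_real (12 * (cbc n / 4 ^ n / (2 * real n + 1)))) at_infinity"
proof -
  define m :: complex where "m = of_nat n"
  define A where "A = 2 * (2 * m + 1)\<^sup>2 * (15 * m + 2)"
  define B where "B = (2 * m + 1) * (86 * m + 19)"
  define C where "C = 4 * (20 * m + 7)"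
  have m: "2 * m + 1 \<noteq> 0"
    using of_nat_odd_neq by (simp add: m_def)
  \<comment> \<open>Numerator and denominator of the rational factor are cubic in z. Dividing both
    by z^3 leaves the leading coefficients 12 and 2m + 1 in the limit.\<close>
  have "((\<lambda>z. (A * inverse z ^ 3 + B * inverse z ^ 2 + C * inverse z + 12) /
              ((2 * m + 1) * (2 * m * inverse z + 1) * ((2 * m + 1) * inverse z + 1)\<^sup>2) * H2 n z)
          \<longlongrightarrow> (A * 0 ^ 3 + B * 0 ^ 2 + C * 0 + 12) /
              ((2 * m + 1) * (2 * m * 0 + 1) * ((2 * m + 1) * 0 + 1)\<^sup>2) * of_real (cbc n / 4 ^ n))
          at_infinity"
    using m by (intro tendsto_intros tendsto_inverse_0 H2_tendsto_at_infinity) auto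
  moreover have "eventually (\<lambda>z.
      (A * inverse z ^ 3 + B * inverse z ^ 2 + C * inverse z + 12) /
        ((2 * m + 1) * (2 * m * inverse z + 1) * ((2 * m + 1) * inverse z + 1)\<^sup>2) * H2 n z = T2 n z)
      at_infinity"
    using eventually_not_equal_at_infinity[of 0]
  proof eventually_elim
    case (elim z)
    have "A + z * P n z = (A * inverse z ^ 3 + B * inverse z ^ 2 + C * inverse z + 12) * z ^ 3"
      using elim by (simp add: P_def B_def C_def m_def field_simps power2_eq_square power3_eq_cube)
    moreover have "(2 * m + 1) * (2 * m + z) * (2 * m + z + 1) ^ 2 =
        ((2 * m + 1) * (2 * m * inverse z + 1) * ((2 * m + 1) * inverse z + 1)\<^sup>2) * z ^ 3"
      using elim by (simp add: field_simps power2_eq_square power3_eq_cube)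
    ultimately have "T2 n z =
        (A * inverse z ^ 3 + B * inverse z ^ 2 + C * inverse z + 12) * z ^ 3 /
        (((2 * m + 1) * (2 * m * inverse z + 1) * ((2 * m + 1) * inverse z + 1)\<^sup>2) * z ^ 3) * H2 n z"
      by (simp only: T2_def A_def m_def)
    thus ?case using elim by simp
  qed
  ultimately have "(T2 n \<longlongrightarrow> (A * 0 ^ 3 + B * 0 ^ 2 + C * 0 + 12) /
              ((2 * m + 1) * (2 * m * 0 + 1) * ((2 * m + 1) * 0 + 1)\<^sup>2) * of_real (cbc n / 4 ^ n))
          at_infinity"
    by (rule Lim_transform_eventually)
  thus ?thesis by (simp add: m_def mult_ac)
qed

text \<open>With r = |n + z| >= n + 1, the numerator is at most 2r + (2n + 1) <= 4r, and r cancels;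
  \<open>H1_bound\<close> with k = 0 gives |H1 n z| <= cbc n.\<close>

lemma T1_bound:
  assumes "Re z \<ge> 1"
  shows "norm (T1 n z) \<le> 4 * (cbc n / (2 * real n + 1))"
proof -
  define r where "r = norm (of_nat n + z)"
  have r: "real n + 1 \<le> r"
    using complex_Re_le_cmod[of "of_nat n + z"] assms by (simp add: r_def)
  have "norm (4 * of_nat n + 2 * z + 1) = norm (2 * (of_nat n + z) + of_nat (2 * n + 1))"
    by (simp add: algebra_simps)
  also have "\<dots> \<le> norm (2 * (of_nat n + z)) + norm (of_nat (2 * n + 1) :: complex)"
    by (rule norm_triangle_ineq)
  also have "\<dots> \<le> 4 * r"
    unfolding norm_of_nat norm_mult using r by (simp add: r_def)
  finally have *: "norm (4 * of_nat n + 2 * z + 1) \<le> 4 * r" .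
  have "norm (T1 n z) = norm (4 * of_nat n + 2 * z + 1) / ((2 * real n + 1) * r) * norm (H1 n z)"
    by (simp add: T1_def norm_mult norm_divide norm_of_nat_odd r_def)
  also have "\<dots> \<le> 4 * r / ((2 * real n + 1) * r) * cbc n"
    using * r H1_bound[of z 0 n] assms by (intro mult_mono divide_right_mono) auto
  also have "\<dots> = 4 * (cbc n / (2 * real n + 1))"
    using r by simp
  finally show ?thesis .
qed

text \<open>With r = |2n + z| the numerator is at most 111 r^3 and the denominator at least r^3.
  Here 111 = 16 + 95, and 95 = 43 + 40 + 12 bounds \<open>P\<close>; the factor 4^(-n) comes from
  \<open>H2_bound\<close> with k = 0.\<close>

lemma T2_bound:
  assumes "Re z \<ge> 1"
  shows "norm (T2 n z) \<le> 111 * (1/4) ^ n"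
proof -
  define r where "r = norm (2 * of_nat n + z)"
  have r: "2 * real n + 1 \<le> r" "norm z \<le> r" "r \<le> norm (2 * of_nat n + z + 1)"
    using complex_Re_le_cmod[of "2 * of_nat n + z"] assms
      norm_add_of_real_mono[of z 0 "2 * real n"]
      norm_add_of_real_mono[of "2 * of_nat n + z" 0 1]
    by (auto simp: r_def add_ac)
  \<comment> \<open>Every linear factor in n is compared with a multiple of 2n + 1 <= r.\<close>
  have lin: "norm (of_nat a * of_nat n + of_nat b :: complex) \<le> real c * r"
    if "a \<le> 2 * c" "b \<le> c" for a b c
  proof -
    have "a * n \<le> (2 * c) * n"
      using that by (intro mult_right_mono) auto
    from add_mono[OF this that(2)] have "a * n + b \<le> c * (2 * n + 1)"
      by (simp add: algebra_simps)
    hence "norm (of_nat (a * n + b) :: complex) \<le> real (c * (2 * n + 1))"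
      unfolding norm_of_nat by (simp only: of_nat_le_iff)
    also have "\<dots> = real c * (2 * real n + 1)"
      by (simp add: algebra_simps)
    also have "\<dots> \<le> real c * r"
      using r by (intro mult_left_mono) auto
    finally show ?thesis by simp
  qed
  have lins: "norm (2 * of_nat n + 1 :: complex) \<le> r" "norm (15 * of_nat n + 2 :: complex) \<le> 8 * r"
       "norm (86 * of_nat n + 19 :: complex) \<le> 43 * r" "norm (20 * of_nat n + 7 :: complex) \<le> 10 * r"
    using lin[of 2 1 1] lin[of 15 8 2] lin[of 86 43 19] lin[of 20 10 7] by simp_all
  have r0: "r \<ge> 0" by (simp add: r_def)
  have "norm ((2 * of_nat n + 1) * (86 * of_nat n + 19) :: complex) \<le> r * (43 * r)"
    unfolding norm_mult by (rule mult_mono) (use lins r0 in auto)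
  moreover have "norm (4 * z * (20 * of_nat n + 7)) \<le> (4 * r) * (10 * r)"
    unfolding norm_mult norm_numeral by (rule mult_mono) (use lins r r0 in auto)
  moreover have "norm (12 * z\<^sup>2) \<le> 12 * r\<^sup>2"
    unfolding norm_mult norm_power norm_numeral using r by (intro mult_left_mono power_mono) auto
  ultimately have "norm (P n z) \<le> r * (43 * r) + (4 * r) * (10 * r) + 12 * r\<^sup>2"
    unfolding P_def by (intro norm_triangle_mono)
  also have "\<dots> = 95 * r\<^sup>2"
    by (simp add: power2_eq_square)
  finally have P: "norm (P n z) \<le> 95 * r\<^sup>2" .
  have "norm (2 * (2 * of_nat n + 1)\<^sup>2 * (15 * of_nat n + 2) :: complex) \<le> (2 * r\<^sup>2) * (8 * r)"
    unfolding norm_mult norm_power norm_numeral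
    by (intro mult_mono[of "2 * _"] mult_left_mono power_mono) (use lins r0 in auto)
  moreover have "norm (z * P n z) \<le> r * (95 * r\<^sup>2)"
    unfolding norm_mult by (rule mult_mono) (use P r r0 in auto)
  ultimately have "norm (2 * (2 * of_nat n + 1)\<^sup>2 * (15 * of_nat n + 2) + z * P n z)
          \<le> (2 * r\<^sup>2) * (8 * r) + r * (95 * r\<^sup>2)"
    by (rule norm_triangle_mono)
  also have "\<dots> = 111 * r ^ 3"
    by (simp add: power2_eq_square power3_eq_cube)
  finally have num: "norm (2 * (2 * of_nat n + 1)\<^sup>2 * (15 * of_nat n + 2) + z * P n z) \<le> 111 * r ^ 3" .
  have "1 * r * r\<^sup>2 \<le> (2 * real n + 1) * r * norm (2 * of_nat n + z + 1) ^ 2"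
    by (intro mult_mono[of "1 * r"] mult_right_mono power_mono) (use r0 r in auto)
  hence den: "r ^ 3 \<le> (2 * real n + 1) * r * norm (2 * of_nat n + z + 1) ^ 2"
    by (simp add: power2_eq_square power3_eq_cube)
  have "norm (T2 n z) = norm (2 * (2 * of_nat n + 1)\<^sup>2 * (15 * of_nat n + 2) + z * P n z) /
          ((2 * real n + 1) * r * norm (2 * of_nat n + z + 1) ^ 2) * norm (H2 n z)"
    by (simp add: T2_def norm_mult norm_divide norm_power norm_of_nat_odd r_def)
  also have "\<dots> \<le> 111 * r ^ 3 / r ^ 3 * (1/4) ^ n"
  proof (rule mult_mono)
    show "norm (H2 n z) \<le> (1/4) ^ n"
      using H2_bound[of z 0 n] assms by (simp add: power_divide)
    show "norm (2 * (2 * of_nat n + 1)\<^sup>2 * (15 * of_nat n + 2) + z * P n z) /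
            ((2 * real n + 1) * r * norm (2 * of_nat n + z + 1) ^ 2) \<le> 111 * r ^ 3 / r ^ 3"
      using num den r by (intro frac_le) auto
  qed (use r0 in auto)
  also have "\<dots> = 111 * (1/4) ^ n"
    using r by simp
  finally show ?thesis .
qed

section \<open>Evaluation of the two series\<close>

lemma T1_sums:
  assumes "x \<notin> \<int>\<^sub>\<le>\<^sub>0"
  shows "(\<lambda>n. T1 n x) sums (of_real pi * (Gamma x * Gamma (x + 1) * rGamma (x + 1/2) ^ 2))"
proof (rule sums_by_WZ_shift[where G = "\<lambda>n x. - (x + 1) * of_nat n / (of_nat n + x) * H1 n x"])
  show "(\<lambda>n. - (x + 1) * of_nat n / (of_nat n + x) * H1 n x) \<longlonglongrightarrow> 0" for x
  proof -
    \<comment> \<open>Written as a linear fraction in n: the coefficient tends to -(x + 1), while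
      \<open>H1\<close> tends to 0.\<close>
    have "(\<lambda>n. (0 + - (x + 1) * of_nat n) / (x + 1 * of_nat n) * H1 n x) \<longlonglongrightarrow> - (x + 1) / 1 * 0"
      by (intro tendsto_mult H1_tendsto_0
            filterlim_compose[OF linear_fraction_tendsto tendsto_of_nat]) auto
    thus ?thesis by (simp add: add.commute)
  qed
  show "(\<lambda>n. of_real (2 * (cbc n / (2 * real n + 1)))) sums (of_real pi :: complex)"
    using sums_mult[OF arcsin_sums[of 1], of 2] by (subst sums_of_real_iff) simp
  show "summable (\<lambda>n. 4 * (cbc n / (2 * real n + 1)))"
    by (intro summable_mult summable_cbc)
qed (use assms WZ_T1 T1_bound T1_tendsto_at_infinity in auto)

lemma T2_sums:
  assumes "x \<notin> \<int>\<^sub>\<le>\<^sub>0"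
  shows "(\<lambda>n. T2 n x) sums (4 * of_real pi * (Gamma x * Gamma (x + 1) * rGamma (x + 1/2) ^ 2))"
proof (rule sums_by_WZ_shift[where G = "\<lambda>n x. - 8 * (x + 1) * of_nat n / (2 * of_nat n + x) * H2 n x"])
  show "(\<lambda>n. - 8 * (x + 1) * of_nat n / (2 * of_nat n + x) * H2 n x) \<longlonglongrightarrow> 0" for x
  proof -
    have "(\<lambda>n. (0 + - 8 * (x + 1) * of_nat n) / (x + 2 * of_nat n) * H2 n x)
            \<longlonglongrightarrow> - 8 * (x + 1) / 2 * 0"
      by (intro tendsto_mult H2_tendsto_0
            filterlim_compose[OF linear_fraction_tendsto tendsto_of_nat]) auto
    thus ?thesis by (simp add: add.commute)
  qed
  \<comment> \<open>The limits of the terms are 12 cbc n / (4^n (2n + 1)), and 12 / 4^n = 24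
    (1/2)^(2n + 1); since arcsin (1/2) = pi/6, the sum is 4 pi.\<close>
  have "(\<lambda>n. 24 * (cbc n / (2 * real n + 1) * (1/2) ^ (2 * n + 1))) sums (24 * arcsin (1/2))"
    by (intro sums_mult arcsin_sums) auto
  moreover have "24 * (cbc n / (2 * real n + 1) * (1/2) ^ (2 * n + 1)) =
      12 * (cbc n / 4 ^ n / (2 * real n + 1))" for n
    by (simp add: power_mult power_divide)
  ultimately have "(\<lambda>n. 12 * (cbc n / 4 ^ n / (2 * real n + 1))) sums (4 * pi)"
    by simp
  hence "(\<lambda>n. of_real (12 * (cbc n / 4 ^ n / (2 * real n + 1)))) sums (of_real (4 * pi) :: complex)"
    by (subst sums_of_real_iff)
  thus "(\<lambda>n. of_real (12 * (cbc n / 4 ^ n / (2 * real n + 1)))) sums (4 * of_real pi :: complex)"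
    by simp
  show "summable (\<lambda>n. 111 * (1/4 :: real) ^ n)"
    by (intro summable_mult summable_geometric) auto
qed (use assms WZ_T2 T2_bound T2_tendsto_at_infinity in auto)

text \<open>The factor 1 / Gamma (x + 1/2)^2 is expressed through the entire function
  \<open>rGamma\<close>; at x = -1/2, -3/2, ... it vanishes, and both series sum to 0.\<close>

theorem theorem2:
  fixes x :: complex
  assumes "x \<notin> \<int>\<^sub>\<le>\<^sub>0"
  shows "(\<lambda>n. (4 * of_nat n + 2 * x + 1) / ((2 * of_nat n + 1) * (of_nat n + x))
             * (pochhammer (1/2 + x) n / pochhammer (1 + x) n)
             * of_nat ((2 * n) choose n) * (1 / 2 ^ (2 * n)))
           sums (of_real pi * (Gamma x * Gamma (x + 1) * rGamma (x + 1/2) ^ 2)) \<and>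
         (\<lambda>n. (2 * (2 * of_nat n + 1) ^ 2 * (15 * of_nat n + 2) + x * P n x)
               / ((2 * of_nat n + 1) * (2 * of_nat n + x) * (2 * of_nat n + x + 1) ^ 2)
             * ((pochhammer (1/2 + x) n) ^ 2
                 / (pochhammer (1 + x/2) n * pochhammer ((1 + x)/2) n))
             * of_nat ((2 * n) choose n) * (1 / 2 ^ (6 * n)))
           sums (4 * of_real pi * (Gamma x * Gamma (x + 1) * rGamma (x + 1/2) ^ 2))"
proof -
  have c: "of_nat ((2 * n) choose n) * (1 / 2 ^ (2 * n)) = (of_real (cbc n) :: complex)"
    and c': "of_nat ((2 * n) choose n) * (1 / 2 ^ (6 * n)) = (of_real (cbc n) / 16 ^ n :: complex)" for n
    by (simp_all add: cbc_def power_mult flip: power_mult_distrib)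
  have H2: "H2 n x = (pochhammer (1/2 + x) n)\<^sup>2 / (pochhammer (1 + x/2) n * pochhammer ((1 + x)/2) n) *
      (of_real (cbc n) / 16 ^ n)" for n
    by (simp add: H2_def)
  have T1: "T1 n x = (4 * of_nat n + 2 * x + 1) / ((2 * of_nat n + 1) * (of_nat n + x))
             * (pochhammer (1/2 + x) n / pochhammer (1 + x) n)
             * of_nat ((2 * n) choose n) * (1 / 2 ^ (2 * n))" for n
    unfolding T1_def H1_def c [symmetric] by (simp only: mult.assoc)
  have T2: "T2 n x = (2 * (2 * of_nat n + 1) ^ 2 * (15 * of_nat n + 2) + x * P n x)
               / ((2 * of_nat n + 1) * (2 * of_nat n + x) * (2 * of_nat n + x + 1) ^ 2)
             * ((pochhammer (1/2 + x) n) ^ 2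
                 / (pochhammer (1 + x/2) n * pochhammer ((1 + x)/2) n))
             * of_nat ((2 * n) choose n) * (1 / 2 ^ (6 * n))" for n
    unfolding T2_def H2 c' [symmetric] by (simp only: mult.assoc)
  show ?thesis
    using T1_sums[OF assms] T2_sums[OF assms] unfolding T1 T2 by (rule conjI)
qed

end
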